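(* Let $S$ be a right inverse ordered semigroup (without zero). If $S$ is left Clifford, then $S$ is a union of group like ordered semigroups; that is, every element of $S$ lies in a subsemigroup of $S$ which, with the induced order, is a group like ordered semigroup.
   Context: An ordered semigroup $(S,\cdot,\leq)$ is a semigroup with a partial order such that $a\leq b$ implies $xa\leq xb$ and $ax\leq bx$ for all $x\in S$. Standing assumption: the ambient ordered semigroup $S$ has no zero element (an element $0$ with $0x=x0=0$ and $0\leq x$ for all $x\in S$); this is not imposed on subsemigroups. For a subset $H$ of an ordered semigroup $T$, $(H]=\{t\in T: t\leq h \text{ for some } h\in H\}$. For $a\in T$: $aT=\{at:t\in T\}$, $Ta=\{ta:t\in T\}$, $aTa=\{ata:t\in T\}$. $T$ is regular if $a\in (aTa]$ for every $a\in T$. A regular ordered semigroup $T$ is group like if for all $a,b\in T$, $a\in (Tb]$ and $b\in (aT]$; it is left Clifford if $(aT]\subseteq (Ta]$ for every $a\in T$. A nonempty $I\subseteq S$ is a left (right) ideal if $SI\subseteq I$ ($IS\subseteq I$) and $(I]\subseteq I$. $L(a)$ and $R(a)$ denote the smallest left, respectively right, ideal of $S$ containing $a$. Green's relation: $a\,\mathcal{R}\,b$ iff $R(a)=R(b)$. $E_{\leq}(S)=\{e\in S: e\leq e^2\}$ is the set of ordered idempotents. $S$ is right inverse if it is regular and every principal left ideal is generated by an $\mathcal{R}$-unique ordered idempotent, i.e. for every $a\in S$ there is $e\in E_{\leq}(S)$ with $L(a)=L(e)$, and any two $e,f\in E_{\leq}(S)$ with $L(e)=L(a)=L(f)$ satisfy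 $e\,\mathcal{R}\,f$. *)

theory Defs
  imports Main
begin

text \<open>
  The order is only constrained on the carrier, so a subsemigroup \<open>T\<close> of \<open>S\<close> with the induced
  order is the instance \<open>ordered_semigroup T mult le\<close> with the same \<open>mult\<close> and \<open>le\<close>.
\<close>

locale ordered_semigroup =
  fixes S :: "'a set"
    and mult :: "'a \<Rightarrow> 'a \<Rightarrow> 'a" (infixl "\<cdot>" 70)
    and le :: "'a \<Rightarrow> 'a \<Rightarrow> bool" (infix "\<sqsubseteq>" 50)
  assumes mult_closed: "\<lbrakk>a \<in> S; b \<in> S\<rbrakk> \<Longrightarrow> a \<cdot> b \<in> S"
    and mult_assoc: "\<lbrakk>a \<in> S; b \<in> S; c \<in> S\<rbrakk> \<Longrightarrow> (a \<cdot> b) \<cdot> c = a \<cdot> (b \<cdot> c)"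
    and le_refl: "reflp_on S (\<sqsubseteq>)"
    and le_antisym: "antisymp_on S (\<sqsubseteq>)"
    and le_trans: "transp_on S (\<sqsubseteq>)"
    and mult_left_mono: "\<lbrakk>a \<in> S; b \<in> S; x \<in> S; a \<sqsubseteq> b\<rbrakk> \<Longrightarrow> x \<cdot> a \<sqsubseteq> x \<cdot> b"
    and mult_right_mono: "\<lbrakk>a \<in> S; b \<in> S; x \<in> S; a \<sqsubseteq> b\<rbrakk> \<Longrightarrow> a \<cdot> x \<sqsubseteq> b \<cdot> x"
begin

definition down_closure :: "'a set \<Rightarrow> 'a set" where
  "down_closure H = {t \<in> S. \<exists>h\<in>H. t \<sqsubseteq> h}"

definition is_zero :: "'a \<Rightarrow> bool" where
  "is_zero z \<longleftrightarrow> z \<in> S \<and> (\<forall>x\<in>S. z \<cdot> x = z \<and> x \<cdot> z = z \<and> z \<sqsubseteq> x)"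

definition left_ideal :: "'a set \<Rightarrow> bool" where
  "left_ideal I \<longleftrightarrow> I \<noteq> {} \<and> I \<subseteq> S \<and> (\<forall>s\<in>S. \<forall>x\<in>I. s \<cdot> x \<in> I) \<and> down_closure I \<subseteq> I"

definition right_ideal :: "'a set \<Rightarrow> bool" where
  "right_ideal I \<longleftrightarrow> I \<noteq> {} \<and> I \<subseteq> S \<and> (\<forall>s\<in>S. \<forall>x\<in>I. x \<cdot> s \<in> I) \<and> down_closure I \<subseteq> I"

definition principal_left_ideal :: "'a \<Rightarrow> 'a set" where
  "principal_left_ideal a = \<Inter>{I. left_ideal I \<and> a \<in> I}"

definition principal_right_ideal :: "'a \<Rightarrow> 'a set" where
  "principal_right_ideal a = \<Inter>{I. right_ideal I \<and> a \<in> I}"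

definition green_R :: "'a \<Rightarrow> 'a \<Rightarrow> bool" where
  "green_R a b \<longleftrightarrow> principal_right_ideal a = principal_right_ideal b"

definition ordered_idempotents :: "'a set" where
  "ordered_idempotents = {e \<in> S. e \<sqsubseteq> e \<cdot> e}"

end

locale ordered_semigroup_without_zero = ordered_semigroup +
  assumes no_zero: "\<not> (\<exists>z. is_zero z)"

locale regular_ordered_semigroup = ordered_semigroup +
  assumes regular: "a \<in> S \<Longrightarrow> a \<in> down_closure {a \<cdot> t \<cdot> a | t. t \<in> S}"

locale group_like_ordered_semigroup = regular_ordered_semigroup +
  assumes group_like_left: "\<lbrakk>a \<in> S; b \<in> S\<rbrakk> \<Longrightarrow> a \<in> down_closure {t \<cdot> b | t. t \<in> S}"
    and group_like_right: "\<lbrakk>a \<in> S; b \<in> S\<rbrakk> \<Longrightarrow> b \<in> down_closure {a \<cdot> t | t. t \<in> S}"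

locale left_Clifford_ordered_semigroup = regular_ordered_semigroup +
  assumes left_Clifford:
    "a \<in> S \<Longrightarrow> down_closure {a \<cdot> t | t. t \<in> S} \<subseteq> down_closure {t \<cdot> a | t. t \<in> S}"

locale right_inverse_ordered_semigroup = regular_ordered_semigroup +
  assumes generated_by_idempotent:
    "a \<in> S \<Longrightarrow> \<exists>e\<in>ordered_idempotents. principal_left_ideal a = principal_left_ideal e"
    and idempotent_R_unique:
    "\<lbrakk>a \<in> S; e \<in> ordered_idempotents; f \<in> ordered_idempotents;
      principal_left_ideal e = principal_left_ideal a;
      principal_left_ideal a = principal_left_ideal f\<rbrakk> \<Longrightarrow> green_R e f"

end

theory Submission
  imports Defs
begin

text \<open>
  By left Cliffordness \<open>R(a) \<subseteq> L(a)\<close>, so every \<open>L(a)\<close> is a two-sided ideal and \<open>\<R> \<subseteq> \<L>\<close>.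
  Conversely, if \<open>a \<sqsubseteq> a x a\<close> then \<open>a x\<close> is an ordered idempotent with \<open>a x \<R> a\<close>, hence also
  \<open>a x \<L> a\<close>; if \<open>a \<L> b\<close>, uniqueness applied to the idempotents so obtained from \<open>a\<close> and \<open>b\<close>
  gives \<open>a \<R> b\<close>. Thus \<open>\<L> = \<R>\<close>, and since \<open>L(a)\<close> is two-sided, each class is a subsemigroup
  in which \<open>b \<sqsubseteq> t c\<close> and \<open>c \<sqsubseteq> b t\<close> can be solved: from a solution \<open>b \<sqsubseteq> s c\<close> in \<open>S\<close> and
  \<open>c \<sqsubseteq> c v c\<close> one takes \<open>t = s c v\<close>, which lies in the class.
\<close>

section \<open>Order-theoretic basics and restriction to subsemigroups\<close>

context ordered_semigroup
begin

lemma le_trans': "\<lbrakk>a \<sqsubseteq> b; b \<sqsubseteq> c; a \<in> S; b \<in> S; c \<in> S\<rbrakk> \<Longrightarrow> a \<sqsubseteq> c"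
  using le_trans by (meson transp_onD)

lemma le_refl': "a \<in> S \<Longrightarrow> a \<sqsubseteq> a"
  using le_refl by (rule reflp_onD)

lemma down_closure_idem: "H \<subseteq> S \<Longrightarrow> down_closure (down_closure H) \<subseteq> down_closure H"
  unfolding down_closure_def using le_trans' by blast

lemma principal_left_ideal_subset: "\<lbrakk>a \<in> I; left_ideal I\<rbrakk> \<Longrightarrow> principal_left_ideal a \<subseteq> I"
  and principal_right_ideal_subset: "\<lbrakk>a \<in> I; right_ideal I\<rbrakk> \<Longrightarrow> principal_right_ideal a \<subseteq> I"
  unfolding principal_left_ideal_def principal_right_ideal_def by blast+

lemma mult_mono:
  assumes "a \<sqsubseteq> b" "c \<sqsubseteq> d" "a \<in> S" "b \<in> S" "c \<in> S" "d \<in> S"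
  shows "a \<cdot> c \<sqsubseteq> b \<cdot> d"
  using assms
  by (intro le_trans'[OF mult_right_mono[of a b c] mult_left_mono[of c d b]]) (simp_all add: mult_closed)

text \<open>All axioms except closure are universal statements about elements, so they pass to
  subsets.\<close>

lemma ordered_semigroup_subset:
  assumes "T \<subseteq> S" "\<And>a b. \<lbrakk>a \<in> T; b \<in> T\<rbrakk> \<Longrightarrow> a \<cdot> b \<in> T"
  shows "ordered_semigroup T (\<cdot>) (\<sqsubseteq>)"
proof
  show "reflp_on T (\<sqsubseteq>)" "antisymp_on T (\<sqsubseteq>)" "transp_on T (\<sqsubseteq>)"
    using reflp_on_subset[OF le_refl] antisymp_on_subset[OF le_antisym]
      transp_on_subset[OF le_trans] assms(1) by blast+
  fix a b assume "a \<in> T" "b \<in> T"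
  then show "a \<cdot> b \<in> T" by (rule assms(2))
next
  fix a b c assume "a \<in> T" "b \<in> T" "c \<in> T"
  then have S: "a \<in> S" "b \<in> S" "c \<in> S" using assms(1) by auto
  then show "(a \<cdot> b) \<cdot> c = a \<cdot> (b \<cdot> c)" by (rule mult_assoc)
  show "c \<cdot> a \<sqsubseteq> c \<cdot> b" "a \<cdot> c \<sqsubseteq> b \<cdot> c" if "a \<sqsubseteq> b"
    using S that mult_left_mono mult_right_mono by auto
qed

end

section \<open>Principal one-sided ideals of a regular ordered semigroup\<close>

context regular_ordered_semigroup
begin

lemma regularE:
  assumes "a \<in> S"
  obtains x where "x \<in> S" "a \<sqsubseteq> a \<cdot> x \<cdot> a"
  using regular[OF assms] by (auto simp: down_closure_def)

lemma left_ideal_down_closure: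
  assumes a: "a \<in> S"
  shows "left_ideal (down_closure {t \<cdot> a | t. t \<in> S})" (is "left_ideal ?I")
  unfolding left_ideal_def
proof (intro conjI ballI)
  have "a \<cdot> a \<in> ?I" using a le_refl' mult_closed by (auto simp: down_closure_def)
  then show "?I \<noteq> {}" by blast
  show "?I \<subseteq> S" by (auto simp: down_closure_def)
  show "down_closure ?I \<subseteq> ?I"
    using a mult_closed by (intro down_closure_idem) auto
  fix s x assume s: "s \<in> S" and "x \<in> ?I"
  then obtain t where t: "t \<in> S" "x \<in> S" "x \<sqsubseteq> t \<cdot> a" by (auto simp: down_closure_def)
  then have "s \<cdot> x \<sqsubseteq> (s \<cdot> t) \<cdot> a" using s a by (simp add: mult_assoc mult_closed mult_left_mono)
  then show "s \<cdot> x \<in> ?I" using s t mult_closed by (auto simp: down_closure_def)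
qed

lemma right_ideal_down_closure:
  assumes a: "a \<in> S"
  shows "right_ideal (down_closure {a \<cdot> t | t. t \<in> S})" (is "right_ideal ?I")
  unfolding right_ideal_def
proof (intro conjI ballI)
  have "a \<cdot> a \<in> ?I" using a le_refl' mult_closed by (auto simp: down_closure_def)
  then show "?I \<noteq> {}" by blast
  show "?I \<subseteq> S" by (auto simp: down_closure_def)
  show "down_closure ?I \<subseteq> ?I"
    using a mult_closed by (intro down_closure_idem) auto
  fix s x assume s: "s \<in> S" and "x \<in> ?I"
  then obtain t where t: "t \<in> S" "x \<in> S" "x \<sqsubseteq> a \<cdot> t" by (auto simp: down_closure_def)
  then have "x \<cdot> s \<sqsubseteq> a \<cdot> (t \<cdot> s)"
    using s a mult_right_mono[of x "a \<cdot> t" s] by (simp add: mult_assoc mult_closed)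
  then show "x \<cdot> s \<in> ?I" using s t mult_closed by (auto simp: down_closure_def)
qed

text \<open>Regularity puts \<open>a\<close> itself into \<open>(Sa]\<close>, because a
  \<sqsubseteq> (a \<cdot> x) \<cdot> a. So \<open>(Sa]\<close> is a left ideal containing
  \<open>a\<close>, and any left ideal containing \<open>a\<close> contains it.\<close>

lemma principal_left_ideal_eq:
  assumes a: "a \<in> S"
  shows "principal_left_ideal a = down_closure {t \<cdot> a | t. t \<in> S}"
proof
  obtain x where "x \<in> S" "a \<sqsubseteq> a \<cdot> x \<cdot> a" using regularE[OF a] by blast
  then have "a \<in> down_closure {t \<cdot> a | t. t \<in> S}"
    using a mult_closed by (auto simp: down_closure_def)
  then show "principal_left_ideal a \<subseteq> down_closure {t \<cdot> a | t. t \<in> S}"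
    using left_ideal_down_closure[OF a] by (rule principal_left_ideal_subset)
  show "down_closure {t \<cdot> a | t. t \<in> S} \<subseteq> principal_left_ideal a"
    unfolding principal_left_ideal_def
  proof (intro Inter_greatest)
    fix I assume "I \<in> {I. left_ideal I \<and> a \<in> I}"
    then have "{t \<cdot> a | t. t \<in> S} \<subseteq> I" and "down_closure I \<subseteq> I"
      unfolding left_ideal_def by blast+
    then show "down_closure {t \<cdot> a | t. t \<in> S} \<subseteq> I"
      unfolding down_closure_def by blast
  qed
qed

lemma principal_right_ideal_eq:
  assumes a: "a \<in> S"
  shows "principal_right_ideal a = down_closure {a \<cdot> t | t. t \<in> S}"
proof
  obtain x where "x \<in> S" "a \<sqsubseteq> a \<cdot> x \<cdot> a" using regularE[OF a] by blast
  then have "a \<in> down_closure {a \<cdot> t | t. t \<in> S}"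
    using a mult_closed mult_assoc by (auto simp: down_closure_def)
  then show "principal_right_ideal a \<subseteq> down_closure {a \<cdot> t | t. t \<in> S}"
    using right_ideal_down_closure[OF a] by (rule principal_right_ideal_subset)
  show "down_closure {a \<cdot> t | t. t \<in> S} \<subseteq> principal_right_ideal a"
    unfolding principal_right_ideal_def
  proof (intro Inter_greatest)
    fix I assume "I \<in> {I. right_ideal I \<and> a \<in> I}"
    then have "{a \<cdot> t | t. t \<in> S} \<subseteq> I" and "down_closure I \<subseteq> I"
      unfolding right_ideal_def by blast+
    then show "down_closure {a \<cdot> t | t. t \<in> S} \<subseteq> I"
      unfolding down_closure_def by blast
  qed
qed

lemma mem_principal_left_ideal:
  "a \<in> S \<Longrightarrow> x \<in> principal_left_ideal a \<longleftrightarrow> x \<in> S \<and> (\<exists>t\<in>S. x \<sqsubseteq> t \<cdot> a)"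
  by (auto simp: principal_left_ideal_eq down_closure_def)

lemma mem_principal_right_ideal:
  "a \<in> S \<Longrightarrow> x \<in> principal_right_ideal a \<longleftrightarrow> x \<in> S \<and> (\<exists>t\<in>S. x \<sqsubseteq> a \<cdot> t)"
  by (auto simp: principal_right_ideal_eq down_closure_def)

lemma principal_left_ideal_self: "a \<in> principal_left_ideal a"
  and principal_right_ideal_self: "a \<in> principal_right_ideal a"
  by (auto simp: principal_left_ideal_def principal_right_ideal_def)

lemma principal_left_ideal_least:
  assumes "a \<in> principal_left_ideal b" "b \<in> S"
  shows "principal_left_ideal a \<subseteq> principal_left_ideal b"
  using assms left_ideal_down_closure[of b]
  by (simp add: principal_left_ideal_eq[OF assms(2)] principal_left_ideal_subset)

lemma principal_right_ideal_least:
  assumes "a \<in> principal_right_ideal b" "b \<in> S"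
  shows "principal_right_ideal a \<subseteq> principal_right_ideal b"
  using assms right_ideal_down_closure[of b]
  by (simp add: principal_right_ideal_eq[OF assms(2)] principal_right_ideal_subset)

lemma principal_left_ideal_closed:
  assumes "a \<in> S"
  shows "x \<in> principal_left_ideal a \<Longrightarrow> x \<in> S"
    and "\<lbrakk>x \<in> principal_left_ideal a; s \<in> S\<rbrakk> \<Longrightarrow> s \<cdot> x \<in> principal_left_ideal a"
    and "\<lbrakk>x \<in> principal_left_ideal a; y \<in> S; y \<sqsubseteq> x\<rbrakk> \<Longrightarrow> y \<in> principal_left_ideal a"
proof -
  have "left_ideal (principal_left_ideal a)"
    using left_ideal_down_closure[OF assms] by (simp add: principal_left_ideal_eq[OF assms])
  then have L: "principal_left_ideal a \<subseteq> S"
      "\<forall>s\<in>S. \<forall>x\<in>principal_left_ideal a. s \<cdot> x \<in> principal_left_ideal a"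
      "down_closure (principal_left_ideal a) \<subseteq> principal_left_ideal a"
    unfolding left_ideal_def by simp_all
  show "x \<in> S" if "x \<in> principal_left_ideal a" using that L(1) by blast
  show "s \<cdot> x \<in> principal_left_ideal a" if "x \<in> principal_left_ideal a" "s \<in> S"
    using that L(2) by blast
  show "y \<in> principal_left_ideal a" if "x \<in> principal_left_ideal a" "y \<in> S" "y \<sqsubseteq> x"
    using that L(3) unfolding down_closure_def by blast
qed

text \<open>Multiplying the regularity inequality by \<open>x\<close> on the right gives the
  idempotent inequality. The same inequality, read as a \<sqsubseteq> (a \<cdot> x) \<cdot> a, puts
  \<open>a\<close> into \<open>R(ax)\<close>. This moves any element to an ordered idempotent of its
  own \<R>-class.\<close>

lemma regular_witness_idempotent:
  assumes a: "a \<in> S" and x: "x \<in> S" and le: "a \<sqsubseteq> a \<cdot> x \<cdot> a"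
  shows "a \<cdot> x \<in> ordered_idempotents"
    and "principal_right_ideal (a \<cdot> x) = principal_right_ideal a"
proof -
  have S: "a \<cdot> x \<in> S" "a \<cdot> x \<cdot> a \<in> S" using a x by (auto simp: mult_closed)
  have "a \<cdot> x \<sqsubseteq> a \<cdot> x \<cdot> a \<cdot> x" using le a x S by (simp add: mult_right_mono)
  also have "a \<cdot> x \<cdot> a \<cdot> x = (a \<cdot> x) \<cdot> (a \<cdot> x)" using a x by (simp add: mult_assoc mult_closed)
  finally show "a \<cdot> x \<in> ordered_idempotents" using S by (simp add: ordered_idempotents_def)
  have "a \<in> principal_right_ideal (a \<cdot> x)"
    using a x S le by (auto simp: mem_principal_right_ideal)
  moreover have "a \<cdot> x \<in> principal_right_ideal a"
    using a x S le_refl' by (auto simp: mem_principal_right_ideal)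
  ultimately show "principal_right_ideal (a \<cdot> x) = principal_right_ideal a"
    using a S by (simp add: principal_right_ideal_least subset_antisym)
qed

end

section \<open>Two-sidedness of left ideals under the left Clifford condition\<close>

context left_Clifford_ordered_semigroup
begin

lemma principal_right_ideal_subset_left:
  "a \<in> S \<Longrightarrow> principal_right_ideal a \<subseteq> principal_left_ideal a"
  by (simp add: left_Clifford principal_left_ideal_eq principal_right_ideal_eq)

text \<open>Here the left Clifford condition allows a right factor to be dropped: \<open>b\<close>
  lies in \<open>R(a)\<close>, hence in \<open>L(a)\<close>.\<close>

lemma mem_principal_left_ideal_of_le_mult:
  assumes "a \<in> S" "s \<in> S" "b \<in> S" "b \<sqsubseteq> a \<cdot> s"
  shows "b \<in> principal_left_ideal a"
proof -
  have "b \<in> principal_right_ideal a" using assms by (auto simp: mem_principal_right_ideal)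
  then show ?thesis using principal_right_ideal_subset_left[OF assms(1)] by blast
qed

text \<open>The product x \<cdot> s lies in \<open>R(x)\<close>, and R(x) \<subseteq> L(x)
  \<subseteq> L(a).\<close>

lemma principal_left_ideal_mult_right:
  assumes "a \<in> S" "x \<in> principal_left_ideal a" "s \<in> S"
  shows "x \<cdot> s \<in> principal_left_ideal a"
proof -
  have "x \<in> S" using assms principal_left_ideal_closed(1)[of a x] by simp
  then have "x \<cdot> s \<in> principal_left_ideal x"
    using assms(3) mult_closed le_refl'
    by (intro mem_principal_left_ideal_of_le_mult[of _ s]) auto
  then show ?thesis using principal_left_ideal_least[OF assms(2,1)] by blast
qed

lemma principal_left_ideal_eq_of_right:
  assumes "a \<in> S" "b \<in> S" "principal_right_ideal a = principal_right_ideal b"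
  shows "principal_left_ideal a = principal_left_ideal b"
proof
  have "a \<in> principal_left_ideal b" "b \<in> principal_left_ideal a"
    using assms principal_right_ideal_subset_left[of a] principal_right_ideal_subset_left[of b]
      principal_right_ideal_self[of a] principal_right_ideal_self[of b] by auto
  then show "principal_left_ideal a \<subseteq> principal_left_ideal b"
    and "principal_left_ideal b \<subseteq> principal_left_ideal a"
    using assms by (simp_all add: principal_left_ideal_least)
qed

end

section \<open>Coincidence of \<L> and \<R>, and the classes as group like subsemigroups\<close>

locale right_inverse_left_Clifford_ordered_semigroup =
  right_inverse_ordered_semigroup + left_Clifford_ordered_semigroup
begin

text \<open>The idempotents a \<cdot> x and b \<cdot> y generate the left ideals \<open>L(a)\<close>
  and \<open>L(b)\<close>, which agree. Uniqueness then gives the middle equality in R(a) = R(a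
  \<cdot> x) = R(b \<cdot> y) = R(b).\<close>

lemma principal_right_ideal_eq_of_left:
  assumes a: "a \<in> S" and b: "b \<in> S" and eq: "principal_left_ideal a = principal_left_ideal b"
  shows "principal_right_ideal a = principal_right_ideal b"
proof -
  have *: "principal_left_ideal (c \<cdot> x) = principal_left_ideal c"
    if "c \<in> S" "x \<in> S" "c \<sqsubseteq> c \<cdot> x \<cdot> c" for c x
    using principal_left_ideal_eq_of_right[OF _ _ regular_witness_idempotent(2)[OF that]] that
    by (simp add: mult_closed)
  obtain x where x: "x \<in> S" "a \<sqsubseteq> a \<cdot> x \<cdot> a" using regularE[OF a] by blast
  obtain y where y: "y \<in> S" "b \<sqsubseteq> b \<cdot> y \<cdot> b" using regularE[OF b] by blast
  have "green_R (a \<cdot> x) (b \<cdot> y)"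
    using idempotent_R_unique[OF a] regular_witness_idempotent(1)[OF a x]
      regular_witness_idempotent(1)[OF b y] *[OF a x] *[OF b y] eq by auto
  then show ?thesis
    using regular_witness_idempotent(2)[OF a x] regular_witness_idempotent(2)[OF b y]
    by (simp add: green_R_def)
qed

lemma group_like_L_class:
  assumes a: "a \<in> S"
  defines "T \<equiv> {b \<in> S. principal_left_ideal b = principal_left_ideal a}"
  shows "group_like_ordered_semigroup T (\<cdot>) (\<sqsubseteq>)"
proof -
  let ?L = "principal_left_ideal a"
  have TS: "T \<subseteq> S" by (auto simp: T_def)
  have T_L: "b \<in> ?L" if "b \<in> T" for b
    using that principal_left_ideal_self by (auto simp: T_def)
  \<comment> \<open>Membership test for the class, used for every witness below: L(a) = L(b)
    \<subseteq> L(t) \<subseteq> L(a).\<close>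
  have TI: "t \<in> T" if "t \<in> ?L" "b \<in> principal_left_ideal t" "b \<in> T" for b t
    using that a principal_left_ideal_closed(1)[OF a that(1)]
      principal_left_ideal_least[of t a] principal_left_ideal_least[of b t]
    unfolding T_def by blast
  \<comment> \<open>These two facts solve the group like inequalities with multipliers in
    \<open>S\<close> only; moving them into \<open>T\<close> is the remaining work. The right-hand
    version needs \<L> \<subseteq> \<R>.\<close>
  have left: "\<exists>s\<in>S. c \<sqsubseteq> s \<cdot> b" if "b \<in> T" "c \<in> T" for b c
    using that T_L[of c] mem_principal_left_ideal[of b c] by (auto simp: T_def)
  have right: "\<exists>s\<in>S. c \<sqsubseteq> b \<cdot> s" if "b \<in> T" "c \<in> T" for b c
    using that principal_right_ideal_eq_of_left[of b c] principal_right_ideal_self[of c]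
      mem_principal_right_ideal[of b c] by (auto simp: T_def)
  have closed: "b \<cdot> c \<in> T" if b: "b \<in> T" and c: "c \<in> T" for b c
  proof -
    have S: "b \<in> S" "c \<in> S" "b \<cdot> c \<in> S" using b c mult_closed TS by auto
    \<comment> \<open>The aim is to bound \<open>b\<close> by a two-sided multiple of b \<cdot> c.
      In b \<sqsubseteq> (b \<cdot> u) \<cdot> b, the first factor lies in the class, so it is below
      some v \<cdot> b, while the last \<open>b\<close> is below c \<cdot> s. This makes b \<cdot> c
      appear in the middle.\<close>
    obtain s where s: "s \<in> S" "b \<sqsubseteq> c \<cdot> s" using right[OF c b] by blast
    obtain u where u: "u \<in> S" "b \<sqsubseteq> b \<cdot> u \<cdot> b" using regularE[OF S(1)] by blast
    have "b \<cdot> u \<in> ?L" using T_L[OF b] a u principal_left_ideal_mult_right by blast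
    moreover have "b \<in> principal_left_ideal (b \<cdot> u)"
      using u S mult_closed by (intro mem_principal_left_ideal_of_le_mult[of _ b]) auto
    ultimately have "b \<cdot> u \<in> T" using TI b by blast
    then obtain v where v: "v \<in> S" "b \<cdot> u \<sqsubseteq> v \<cdot> b" using left[OF b] by blast
    have "b \<cdot> u \<cdot> b \<sqsubseteq> (v \<cdot> b) \<cdot> (c \<cdot> s)"
      using u v s S mult_mono[OF v(2) s(2)] by (simp add: mult_closed)
    then have "b \<sqsubseteq> (v \<cdot> b) \<cdot> (c \<cdot> s)"
      using u v s S le_trans'[OF u(2)] by (simp add: mult_closed)
    also have "(v \<cdot> b) \<cdot> (c \<cdot> s) = v \<cdot> (b \<cdot> c) \<cdot> s"
      using v s S by (simp add: mult_assoc mult_closed)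
    finally have "b \<sqsubseteq> v \<cdot> (b \<cdot> c) \<cdot> s" .
    moreover have "v \<cdot> (b \<cdot> c) \<cdot> s \<in> principal_left_ideal (b \<cdot> c)"
      using v s S by (simp add: principal_left_ideal_mult_right principal_left_ideal_closed(2)
          principal_left_ideal_self)
    ultimately have "b \<in> principal_left_ideal (b \<cdot> c)"
      using S principal_left_ideal_closed(3) by blast
    moreover have "b \<cdot> c \<in> ?L" using T_L[OF b] a S principal_left_ideal_mult_right by blast
    ultimately show ?thesis using TI b by blast
  qed
  interpret T: ordered_semigroup T "(\<cdot>)" "(\<sqsubseteq>)"
    using ordered_semigroup_subset[OF TS closed] .
  show ?thesis
  proof
    fix b c assume b: "b \<in> T" and c: "c \<in> T"
    have S: "b \<in> S" "c \<in> S" using b c TS by auto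
    obtain u where u: "u \<in> S" "b \<sqsubseteq> b \<cdot> u \<cdot> b" using regularE[OF S(1)] by blast
    obtain v where v: "v \<in> S" "c \<sqsubseteq> c \<cdot> v \<cdot> c" using regularE[OF S(2)] by blast
    obtain s where s: "s \<in> S" "b \<sqsubseteq> s \<cdot> c" using left[OF c b] by blast
    have "s \<cdot> c \<sqsubseteq> s \<cdot> (c \<cdot> v \<cdot> c)" using s S v by (simp add: mult_closed mult_left_mono)
    then have le: "b \<sqsubseteq> (s \<cdot> c \<cdot> v) \<cdot> c"
      using s S v le_trans'[OF s(2)] by (simp add: mult_assoc mult_closed)
    \<comment> \<open>The factor \<open>c\<close> keeps the product in the two-sided ideal
      \<open>L(a)\<close>, and \<open>le\<close> puts \<open>b\<close> into its left ideal after the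
      right factor \<open>c\<close> is dropped.\<close>
    have "s \<cdot> c \<cdot> v \<in> T"
    proof (rule TI[OF _ _ b])
      show "s \<cdot> c \<cdot> v \<in> ?L" using T_L[OF c] a s v
        by (simp add: principal_left_ideal_mult_right principal_left_ideal_closed(2))
      show "b \<in> principal_left_ideal (s \<cdot> c \<cdot> v)"
        using le s S v by (intro mem_principal_left_ideal_of_le_mult[of _ c]) (auto simp: mult_closed)
    qed
    then show "b \<in> T.down_closure {t \<cdot> c | t. t \<in> T}"
      using le b by (auto simp: T.down_closure_def)
    obtain r where r: "r \<in> S" "c \<sqsubseteq> b \<cdot> r" using right[OF b c] by blast
    \<comment> \<open>On this side regularity of \<open>b\<close> replaces \<open>r\<close> by u
      \<cdot> b \<cdot> r, whose factor \<open>b\<close> keeps it in \<open>L(a)\<close>. Since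
      \<open>c\<close> is below a left multiple of it, the membership test applies directly.\<close>
    have "b \<cdot> r \<sqsubseteq> (b \<cdot> u \<cdot> b) \<cdot> r" using r S u by (simp add: mult_closed mult_right_mono)
    then have le: "c \<sqsubseteq> b \<cdot> (u \<cdot> b \<cdot> r)"
      using r S u le_trans'[OF r(2)] by (simp add: mult_assoc mult_closed)
    have "u \<cdot> b \<cdot> r \<in> T"
    proof (rule TI[OF _ _ c])
      show "u \<cdot> b \<cdot> r \<in> ?L" using T_L[OF b] a r u
        by (simp add: principal_left_ideal_mult_right principal_left_ideal_closed(2))
      show "c \<in> principal_left_ideal (u \<cdot> b \<cdot> r)"
        using le r S u by (auto simp: mem_principal_left_ideal mult_closed)
    qed
    then show "c \<in> T.down_closure {b \<cdot> t | t. t \<in> T}"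
      using le c by (auto simp: T.down_closure_def)
  next
    fix b assume b: "b \<in> T"
    have S: "b \<in> S" using b TS by auto
    obtain u where u: "u \<in> S" "b \<sqsubseteq> b \<cdot> u \<cdot> b" using regularE[OF S] by blast
    \<comment> \<open>The witness \<open>u\<close> may lie outside the class. Using regularity twice
      replaces it by u \<cdot> b \<cdot> u, which lies in \<open>L(a)\<close> through its factor
      \<open>b\<close>.\<close>
    have "b \<cdot> u \<cdot> b \<sqsubseteq> b \<cdot> u \<cdot> (b \<cdot> u \<cdot> b)" using u S by (simp add: mult_closed mult_left_mono)
    then have le: "b \<sqsubseteq> b \<cdot> (u \<cdot> b \<cdot> u) \<cdot> b"
      using u S le_trans'[OF u(2)] by (simp add: mult_assoc mult_closed)
    have "u \<cdot> b \<cdot> u \<in> T"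
    proof (rule TI[OF _ _ b])
      show "u \<cdot> b \<cdot> u \<in> ?L" using T_L[OF b] a u
        by (simp add: principal_left_ideal_mult_right principal_left_ideal_closed(2))
      have "b \<cdot> (u \<cdot> b \<cdot> u) \<cdot> b \<in> principal_left_ideal (u \<cdot> b \<cdot> u)"
        using u S by (simp add: principal_left_ideal_mult_right principal_left_ideal_closed(2)
            principal_left_ideal_self mult_closed)
      then show "b \<in> principal_left_ideal (u \<cdot> b \<cdot> u)"
        using le S u principal_left_ideal_closed(3)[of "u \<cdot> b \<cdot> u"] by (simp add: mult_closed)
    qed
    then show "b \<in> T.down_closure {b \<cdot> t \<cdot> b | t. t \<in> T}"
      using le b by (auto simp: T.down_closure_def)
  qed
qed

end

theorem theorem3p12:
  fixes S :: "'a set"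
    and mult :: "'a \<Rightarrow> 'a \<Rightarrow> 'a"
    and le :: "'a \<Rightarrow> 'a \<Rightarrow> bool"
  assumes "ordered_semigroup_without_zero S mult le"
    and "right_inverse_ordered_semigroup S mult le"
    and "left_Clifford_ordered_semigroup S mult le"
  shows "\<forall>a\<in>S. \<exists>T. T \<subseteq> S \<and> a \<in> T \<and> group_like_ordered_semigroup T mult le"
proof
  fix a assume a: "a \<in> S"
  interpret right_inverse_left_Clifford_ordered_semigroup S mult le
    using assms(2,3) by (rule right_inverse_left_Clifford_ordered_semigroup.intro)
  \<comment> \<open>The subsemigroup is the \<L>-class of \<open>a\<close>.\<close>
  show "\<exists>T. T \<subseteq> S \<and> a \<in> T \<and> group_like_ordered_semigroup T mult le"
    using group_like_L_class[OF a] a by (intro exI conjI) auto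
qed

end
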